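(* Let $n\ge 1$ be an integer. A generic matrix in $\mathbb{C}^{n\times n}$ is a product of $n$ companion matrices of size $n\times n$.
   Context: An $n\times n$ companion matrix is a matrix of the form \[ \begin{bmatrix} 0 & 0 &\cdots & 0 &c_1\\ 1 & 0 &\cdots & 0 &c_2\\ \vdots & \vdots & \ddots&\vdots & \vdots\\ 0 & 0 &\cdots & 1 & c_n \end{bmatrix} \] with arbitrary $c_1,\dots,c_n\in\mathbb{C}$ (ones on the first subdiagonal, last column $(c_1,\dots,c_n)^{\mathsf T}$, zeros elsewhere). An algebraic subvariety of $\mathbb{C}^N$ is the zero set of finitely many polynomials. A property holds for a generic matrix in $\mathbb{C}^{n\times n}$ if there is an algebraic subvariety $Z\subsetneq\mathbb{C}^{n\times n}$ such that every matrix not having the property lies in $Z$. *)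

theory Defs
  imports Complex_Main "HOL-Library.Poly_Mapping" "Jordan_Normal_Form.Matrix"
begin

definition companion_matrix :: "nat \<Rightarrow> 'a :: semiring_1 vec \<Rightarrow> 'a mat" where
  "companion_matrix n c =
     mat n n (\<lambda>(i, j). if j = n - 1 then c $ i else if i = j + 1 then 1 else 0)"

definition is_companion_matrix :: "nat \<Rightarrow> 'a :: semiring_1 mat \<Rightarrow> bool" where
  "is_companion_matrix n A \<longleftrightarrow> (\<exists>c \<in> carrier_vec n. A = companion_matrix n c)"

definition mat_prod_list :: "nat \<Rightarrow> 'a :: semiring_1 mat list \<Rightarrow> 'a mat" where
  "mat_prod_list n As = foldr (*) As (1\<^sub>m n)"

definition is_companion_product :: "nat \<Rightarrow> nat \<Rightarrow> 'a :: semiring_1 mat \<Rightarrow> bool" where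
  "is_companion_product n k A \<longleftrightarrow>
     (\<exists>Cs. length Cs = k \<and> (\<forall>C \<in> set Cs. is_companion_matrix n C) \<and> A = mat_prod_list n Cs)"

text \<open>
  A polynomial over \<open>'a\<close> in indeterminates from \<open>'x\<close> is a finitely supported function from
  monomials to coefficients, a monomial being a finitely supported function from
  indeterminates to exponents.
\<close>

type_synonym ('x, 'a) multipoly = "('x \<Rightarrow>\<^sub>0 nat) \<Rightarrow>\<^sub>0 'a"

definition multipoly_vars :: "('x, 'a :: zero) multipoly \<Rightarrow> 'x set" where
  "multipoly_vars p = (\<Union>m \<in> Poly_Mapping.keys p. Poly_Mapping.keys m)"

definition multipoly_eval :: "('x \<Rightarrow> 'a) \<Rightarrow> ('x, 'a :: comm_semiring_1) multipoly \<Rightarrow> 'a" where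
  "multipoly_eval a p =
     (\<Sum>m \<in> Poly_Mapping.keys p. Poly_Mapping.lookup p m *
        (\<Prod>x \<in> Poly_Mapping.keys m. a x ^ Poly_Mapping.lookup m x))"

text \<open>
  Subvarieties of the space of \<open>n \<times> n\<close> matrices, seen as the affine space whose
  coordinates are the matrix entries: the indeterminates are the positions \<open>(i, j)\<close>
  with \<open>i, j < n\<close>.
\<close>

definition algebraic_subvariety_mat :: "nat \<Rightarrow> complex mat set \<Rightarrow> bool" where
  "algebraic_subvariety_mat n Z \<longleftrightarrow>
     (\<exists>F :: (nat \<times> nat, complex) multipoly set.
        finite F \<and> (\<forall>p \<in> F. multipoly_vars p \<subseteq> {..<n} \<times> {..<n}) \<and>
        Z = {A \<in> carrier_mat n n. \<forall>p \<in> F. multipoly_eval (\<lambda>ij. A $$ ij) p = 0})"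

definition holds_for_generic_matrix :: "nat \<Rightarrow> (complex mat \<Rightarrow> bool) \<Rightarrow> bool" where
  "holds_for_generic_matrix n P \<longleftrightarrow>
     (\<exists>Z. algebraic_subvariety_mat n Z \<and> Z \<subset> carrier_mat n n \<and>
        (\<forall>A \<in> carrier_mat n n. \<not> P A \<longrightarrow> A \<in> Z))"

end

theory Submission
  imports Defs "Jordan_Normal_Form.Determinant"
begin

text \<open>
  Right multiplication by the companion matrix with last column \<open>c\<close> drops the first column of
  a matrix \<open>M\<close>, moves the others one place to the left and appends the column \<open>M c\<close>.
  A product of \<open>n\<close> companion matrices is therefore obtained from the identity matrix by letting a
  window of width \<open>n\<close> slide along the sequence \<open>e\<^sub>1, \<dots>, e\<^sub>n, v\<^sub>1, \<dots>, v\<^sub>n\<close>, where each new vector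
  \<open>v\<^sub>k\<close> may be any linear combination of the \<open>n\<close> vectors before it, and the final window is the
  product. Given a matrix \<open>A\<close>, let \<open>v\<^sub>1, \<dots>, v\<^sub>n\<close> be its columns. If every window but the last one is
  an invertible matrix, then each column of \<open>A\<close> is a combination of the preceding \<open>n\<close> vectors, so
  \<open>A\<close> is a product of \<open>n\<close> companion matrices (\<open>is_companion_product_window\<close>).

  The exceptional matrices thus lie in the zero set of a single polynomial in the entries of \<open>A\<close>,
  the product of the determinants of the windows (\<open>polynomial_function_det\<close>). This zero set is a
  proper subvariety: for the identity matrix all windows are permutation matrices
  (\<open>det_window_one_nonzero\<close>).
\<close>

section \<open>Polynomial functions\<close>

definition polynomial_function ::
  "'x set \<Rightarrow> (('x \<Rightarrow> 'a) \<Rightarrow> 'a :: comm_semiring_1) \<Rightarrow> bool" where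
  "polynomial_function X f \<longleftrightarrow> (\<exists>p. multipoly_vars p \<subseteq> X \<and> (\<forall>a. multipoly_eval a p = f a))"

definition monomial_eval :: "('x \<Rightarrow> 'a) \<Rightarrow> ('x \<Rightarrow>\<^sub>0 nat) \<Rightarrow> 'a :: comm_semiring_1" where
  "monomial_eval a m = (\<Prod>x \<in> Poly_Mapping.keys m. a x ^ Poly_Mapping.lookup m x)"

lemma multipoly_eval_conv_monomial_eval:
  "multipoly_eval a p =
     (\<Sum>m \<in> Poly_Mapping.keys p. Poly_Mapping.lookup p m * monomial_eval a m)"
  by (simp add: multipoly_eval_def monomial_eval_def)

lemma monomial_eval_superset:
  assumes "finite S" "Poly_Mapping.keys m \<subseteq> S"
  shows "monomial_eval a m = (\<Prod>x\<in>S. a x ^ Poly_Mapping.lookup m x)"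
  unfolding monomial_eval_def using assms
  by (intro prod.mono_neutral_left) (auto simp: in_keys_iff)

lemma multipoly_eval_superset:
  assumes "finite S" "Poly_Mapping.keys p \<subseteq> S"
  shows "multipoly_eval a p = (\<Sum>m\<in>S. Poly_Mapping.lookup p m * monomial_eval a m)"
  unfolding multipoly_eval_conv_monomial_eval using assms
  by (intro sum.mono_neutral_left) (auto simp: in_keys_iff)

lemma monomial_eval_add: "monomial_eval a (m + m') = monomial_eval a m * monomial_eval a m'"
proof -
  let ?S = "Poly_Mapping.keys m \<union> Poly_Mapping.keys m'"
  have "Poly_Mapping.keys (m + m') \<subseteq> ?S" by (rule Poly_Mapping.keys_add)
  then show ?thesis
    by (simp add: monomial_eval_superset[of ?S] lookup_add power_add prod.distrib)
qed

lemma multipoly_eval_add: "multipoly_eval a (p + q) = multipoly_eval a p + multipoly_eval a q"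
proof -
  let ?S = "Poly_Mapping.keys p \<union> Poly_Mapping.keys q"
  have "Poly_Mapping.keys (p + q) \<subseteq> ?S" by (rule Poly_Mapping.keys_add)
  then show ?thesis
    by (simp add: multipoly_eval_superset[of ?S] lookup_add distrib_right sum.distrib)
qed

lemma multipoly_eval_single:
  "multipoly_eval a (Poly_Mapping.single m c) = c * monomial_eval a m"
  by (simp add: multipoly_eval_conv_monomial_eval)

lemma polynomial_function_monomial:
  assumes "Poly_Mapping.keys m \<subseteq> X"
  shows "polynomial_function X (\<lambda>a. c * monomial_eval a m)"
  unfolding polynomial_function_def
  using assms
  by (intro exI[of _ "Poly_Mapping.single m c"])
     (auto simp: multipoly_eval_single multipoly_vars_def)

lemma polynomial_function_const: "polynomial_function X (\<lambda>a. c)"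
  using polynomial_function_monomial[of 0 X c] by (simp add: monomial_eval_def)

lemma polynomial_function_var: "x \<in> X \<Longrightarrow> polynomial_function X (\<lambda>a. a x)"
  using polynomial_function_monomial[of "Poly_Mapping.single x 1" X 1]
  by (simp add: monomial_eval_def)

lemma polynomial_function_add:
  assumes "polynomial_function X f" "polynomial_function X g"
  shows "polynomial_function X (\<lambda>a. f a + g a)"
proof -
  from assms obtain p q where
    p: "multipoly_vars p \<subseteq> X" "\<And>a. multipoly_eval a p = f a" and
    q: "multipoly_vars q \<subseteq> X" "\<And>a. multipoly_eval a q = g a"
    unfolding polynomial_function_def by blast
  have "multipoly_vars (p + q) \<subseteq> multipoly_vars p \<union> multipoly_vars q"
    using Poly_Mapping.keys_add[of p q] unfolding multipoly_vars_def by blast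
  then show ?thesis
    unfolding polynomial_function_def using p q
    by (intro exI[of _ "p + q"]) (auto simp: multipoly_eval_add)
qed

lemma polynomial_function_sum:
  "(\<And>i. i \<in> I \<Longrightarrow> polynomial_function X (f i)) \<Longrightarrow> polynomial_function X (\<lambda>a. \<Sum>i\<in>I. f i a)"
  by (induction I rule: infinite_finite_induct)
     (auto intro: polynomial_function_const polynomial_function_add)

text \<open>
  Both factors are expanded into monomials; the product of two monomials is again a monomial,
  with the exponents added, and the general case follows by summation.
\<close>

lemma polynomial_function_mult:
  assumes "polynomial_function X f" "polynomial_function X g"
  shows "polynomial_function X (\<lambda>a. f a * g a)"
proof -
  from assms obtain p q where
    p: "multipoly_vars p \<subseteq> X" "\<And>a. multipoly_eval a p = f a" and
    q: "multipoly_vars q \<subseteq> X" "\<And>a. multipoly_eval a q = g a"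
    unfolding polynomial_function_def by blast
  have "f a * g a = (\<Sum>m\<in>Poly_Mapping.keys p. \<Sum>m'\<in>Poly_Mapping.keys q.
      (Poly_Mapping.lookup p m * Poly_Mapping.lookup q m') * monomial_eval a (m + m'))" for a
    by (simp add: multipoly_eval_conv_monomial_eval sum_product monomial_eval_add ac_simps
        flip: p(2) q(2))
  moreover have "Poly_Mapping.keys (m + m') \<subseteq> X"
    if "m \<in> Poly_Mapping.keys p" "m' \<in> Poly_Mapping.keys q" for m m'
    using that p(1) q(1) Poly_Mapping.keys_add[of m m'] unfolding multipoly_vars_def by blast
  ultimately show ?thesis
    by (simp add: polynomial_function_sum polynomial_function_monomial)
qed

lemma polynomial_function_prod:
  "(\<And>i. i \<in> I \<Longrightarrow> polynomial_function X (f i)) \<Longrightarrow> polynomial_function X (\<lambda>a. \<Prod>i\<in>I. f i a)"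
  by (induction I rule: infinite_finite_induct)
     (auto intro: polynomial_function_const polynomial_function_mult)

lemma polynomial_function_det:
  fixes M :: "('x \<Rightarrow> 'a :: comm_ring_1) \<Rightarrow> 'a mat"
  assumes "\<And>a. M a \<in> carrier_mat n n"
    and "\<And>i j. i < n \<Longrightarrow> j < n \<Longrightarrow> polynomial_function X (\<lambda>a. M a $$ (i, j))"
  shows "polynomial_function X (\<lambda>a. det (M a))"
proof -
  have "det (M a) = (\<Sum>\<pi> \<in> {\<pi>. \<pi> permutes {0..<n}}. signof \<pi> * (\<Prod>i = 0..<n. M a $$ (i, \<pi> i)))"
    for a using assms(1) by (rule det_def')
  moreover have "polynomial_function X (\<lambda>a. M a $$ (i, \<pi> i))"
    if "\<pi> permutes {0..<n}" "i \<in> {0..<n}" for \<pi> i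
    using that permutes_in_image[OF that(1), of i] by (intro assms(2)) auto
  ultimately show ?thesis
    by (auto intro!: polynomial_function_sum polynomial_function_mult polynomial_function_prod
        polynomial_function_const)
qed

section \<open>Sliding windows and companion matrices\<close>

text \<open>
  The columns \<open>k, \<dots>, k + n - 1\<close> of the \<open>n \<times> 2n\<close> block matrix \<open>[I | A]\<close>, counted from \<open>0\<close>.
\<close>

definition window :: "nat \<Rightarrow> 'a :: semiring_1 mat \<Rightarrow> nat \<Rightarrow> 'a mat" where
  "window n A k = mat n n (\<lambda>(i, j).
     if k + j < n then (if i = k + j then 1 else 0) else A $$ (i, k + j - n))"

lemma window_carrier [simp]: "window n A k \<in> carrier_mat n n"
  by (simp add: window_def)

lemma window_0: "window n A 0 = 1\<^sub>m n"
  by (auto simp: window_def)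

lemma window_full: "A \<in> carrier_mat n n \<Longrightarrow> window n A n = A"
  by (auto simp: window_def)

lemma companion_matrix_carrier [simp]: "companion_matrix n c \<in> carrier_mat n n"
  by (simp add: companion_matrix_def)

lemma col_companion_matrix_last:
  "c \<in> carrier_vec n \<Longrightarrow> 0 < n \<Longrightarrow> col (companion_matrix n c) (n - 1) = c"
  by (auto simp: companion_matrix_def)

lemma col_companion_matrix_unit:
  "Suc j < n \<Longrightarrow> col (companion_matrix n c) j = unit_vec n (Suc j)"
  by (intro eq_vecI) (auto simp: companion_matrix_def)

lemma window_Suc:
  fixes A :: "'a :: comm_ring_1 mat"
  assumes "k < n" and c: "c \<in> carrier_vec n" and "A \<in> carrier_mat n n"
    and comb: "window n A k *\<^sub>v c = col A k"
  shows "window n A (Suc k) = window n A k * companion_matrix n c" (is "?L = ?M * ?C")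
proof (rule mat_col_eqI)
  fix j assume "j < dim_col (?M * ?C)"
  then have j: "j < n" by (simp add: companion_matrix_def)
  have colprod: "col (?M * ?C) j = ?M *\<^sub>v col ?C j"
    using j by (intro col_mult2[of _ n n _ n]) auto
  show "col ?L j = col (?M * ?C) j"
  proof (cases "Suc j < n")
    case True
    then have "col (?M * ?C) j = col ?M (Suc j)"
      unfolding colprod
      by (intro eq_vecI) (auto simp: col_companion_matrix_unit window_def)
    also have "\<dots> = col ?L j"
      using True by (auto simp: window_def)
    finally show ?thesis by simp
  next
    case False
    then have "j = n - 1" using j by simp
    then have "col ?C j = c" using col_companion_matrix_last[OF c] j by simp
    then have "col (?M * ?C) j = col A k" using colprod comb by simp
    also have "\<dots> = col ?L j"
      using \<open>j = n - 1\<close> assms by (auto simp: window_def)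
    finally show ?thesis by simp
  qed
qed (auto simp: window_def companion_matrix_def)

lemma mat_prod_list_snoc:
  assumes "\<forall>B \<in> set Bs. B \<in> carrier_mat n n" "C \<in> carrier_mat n n"
  shows "mat_prod_list n Bs \<in> carrier_mat n n \<and>
    mat_prod_list n (Bs @ [C]) = mat_prod_list n Bs * C"
  using assms
proof (induction Bs)
  case Nil
  then show ?case by (simp add: mat_prod_list_def)
next
  case (Cons B Bs)
  then show ?case by (auto simp: mat_prod_list_def assoc_mult_mat[of B n n _ n C n])
qed

lemma is_companion_product_snoc:
  assumes "is_companion_product n k B" "c \<in> carrier_vec n"
  shows "is_companion_product n (Suc k) (B * companion_matrix n c)"
proof -
  from assms(1) obtain Cs where Cs: "length Cs = k" "\<forall>C \<in> set Cs. is_companion_matrix n C"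
    "B = mat_prod_list n Cs"
    unfolding is_companion_product_def by blast
  have "\<forall>C \<in> set Cs. C \<in> carrier_mat n n"
    using Cs(2) by (auto simp: is_companion_matrix_def)
  from mat_prod_list_snoc[OF this companion_matrix_carrier[of n c]]
  show ?thesis
    unfolding is_companion_product_def using Cs assms(2)
    by (intro exI[of _ "Cs @ [companion_matrix n c]"]) (auto simp: is_companion_matrix_def)
qed

text \<open>
  Invertibility of the window provides the coefficients that express the next column of \<open>A\<close>
  through the columns of the window; they form the last column of the next companion factor.
\<close>

lemma is_companion_product_window:
  fixes A :: "'a :: field mat"
  assumes A: "A \<in> carrier_mat n n" and "\<And>l. l < k \<Longrightarrow> det (window n A l) \<noteq> 0" and "k \<le> n"
  shows "is_companion_product n k (window n A k)"
  using assms(2,3)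
proof (induction k)
  case 0
  then show ?case by (simp add: window_0 is_companion_product_def mat_prod_list_def)
next
  case (Suc k)
  let ?M = "window n A k"
  have "det ?M \<noteq> 0" using Suc.prems by simp
  then obtain N where N: "N \<in> carrier_mat n n" "?M * N = 1\<^sub>m n"
    using det_non_zero_imp_unit[OF window_carrier, of n A k]
    by (auto simp: Units_def ring_mat_def)
  have colA: "col A k \<in> carrier_vec n" using A col_dim[of A k] by (simp only: carrier_matD)
  define c where "c = N *\<^sub>v col A k"
  have c: "c \<in> carrier_vec n" unfolding c_def by (rule mult_mat_vec_carrier[OF N(1) colA])
  have "?M *\<^sub>v c = (?M * N) *\<^sub>v col A k"
    unfolding c_def by (rule assoc_mult_mat_vec[OF window_carrier N(1) colA, symmetric])
  also have "\<dots> = col A k" by (simp only: N(2) one_mult_mat_vec[OF colA])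
  finally have "window n A (Suc k) = ?M * companion_matrix n c"
    using window_Suc[OF _ c A] Suc.prems by simp
  then show ?case
    using is_companion_product_snoc[OF Suc.IH c] Suc.prems by simp
qed

section \<open>The exceptional subvariety\<close>

lemma polynomial_function_window_entry:
  assumes "k < n" "i < n" "j < n"
  shows "polynomial_function ({..<n} \<times> {..<n}) (\<lambda>a. window n (mat n n a) k $$ (i, j))"
proof (cases "k + j < n")
  case True
  then show ?thesis using assms by (simp add: window_def polynomial_function_const)
next
  case False
  then have "k + j - n < n" using assms by simp
  then show ?thesis using assms False by (simp add: window_def polynomial_function_var)
qed

text \<open>
  The windows of \<open>[I | I]\<close> are cyclic permutation matrices. Their columns are distinct unit
  vectors, hence they are orthogonal matrices.
\<close>

lemma det_window_one_nonzero:
  assumes "k < n"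
  shows "det (window n (1\<^sub>m n :: 'a :: field mat) k) \<noteq> 0"
proof -
  let ?W = "window n (1\<^sub>m n :: 'a mat) k"
  let ?s = "\<lambda>j. if k + j < n then k + j else k + j - n"
  have s: "?s j < n" if "j < n" for j using that assms by auto
  have inj: "?s i = ?s j \<longleftrightarrow> i = j" if "i < n" "j < n" for i j using that assms by auto
  have col: "col ?W j = unit_vec n (?s j)" if "j < n" for j
    using that assms by (auto simp: window_def unit_vec_def)
  have "?W\<^sup>T * ?W = 1\<^sub>m n"
  proof (rule eq_matI)
    fix i j assume "i < dim_row (1\<^sub>m n :: 'a mat)" "j < dim_col (1\<^sub>m n :: 'a mat)"
    then have ij: "i < n" "j < n" by auto
    have dims: "dim_row ?W = n" "dim_col ?W = n" by (auto simp: window_def)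
    have "(?W\<^sup>T * ?W) $$ (i, j) = col ?W i \<bullet> col ?W j"
      using ij dims by simp
    also have "\<dots> = (unit_vec n (?s j) :: 'a vec) $ ?s i"
      using s[OF ij(1)] unfolding col[OF ij(1)] col[OF ij(2)]
      by (intro scalar_prod_left_unit) auto
    also have "\<dots> = (if i = j then 1 else 0)"
      using s[OF ij(1)] s[OF ij(2)] inj[OF ij] by (simp only: index_unit_vec)
    finally show "(?W\<^sup>T * ?W) $$ (i, j) = 1\<^sub>m n $$ (i, j)" using ij by simp
  qed (auto simp: window_def)
  then have "det ?W\<^sup>T * det ?W = 1"
    using det_mult[of "?W\<^sup>T" n ?W] by simp
  then show ?thesis by auto
qed

theorem proposition6p1:
  fixes n :: nat
  assumes "n \<ge> 1"
  shows "holds_for_generic_matrix n (is_companion_product n n)"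
proof -
  let ?X = "{..<n} \<times> {..<n}"
  have "polynomial_function ?X
      (\<lambda>a :: nat \<times> nat \<Rightarrow> complex. \<Prod>k<n. det (window n (mat n n a) k))"
    by (intro polynomial_function_prod polynomial_function_det[where n = n]
        polynomial_function_window_entry) auto
  then obtain p :: "(nat \<times> nat, complex) multipoly" where vars: "multipoly_vars p \<subseteq> ?X"
    and p: "\<And>a. multipoly_eval a p = (\<Prod>k<n. det (window n (mat n n a) k))"
    unfolding polynomial_function_def by blast
  have eval: "multipoly_eval (\<lambda>ij. A $$ ij) p = 0 \<longleftrightarrow> (\<exists>k<n. det (window n A k) = 0)"
    if "A \<in> carrier_mat n n" for A
  proof -
    have "mat n n (\<lambda>ij. A $$ ij) = A" using that by auto
    then show ?thesis by (auto simp: p)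
  qed
  define Z where "Z = {A \<in> carrier_mat n n. multipoly_eval (\<lambda>ij. A $$ ij) p = 0}"
  have "algebraic_subvariety_mat n Z"
    unfolding algebraic_subvariety_mat_def Z_def using vars by (intro exI[of _ "{p}"]) auto
  moreover have "1\<^sub>m n \<in> carrier_mat n n - Z"
    using eval[of "1\<^sub>m n"] det_window_one_nonzero[of _ n] by (auto simp: Z_def)
  moreover have "Z \<subseteq> carrier_mat n n" unfolding Z_def by (rule Collect_restrict)
  ultimately have "algebraic_subvariety_mat n Z" "Z \<subset> carrier_mat n n" by blast+
  moreover have "A \<in> Z"
    if A: "A \<in> carrier_mat n n" and "\<not> is_companion_product n n A" for A
    using that is_companion_product_window[OF A, of n] eval[OF A]
    by (auto simp: Z_def window_full)
  ultimately show ?thesis unfolding holds_for_generic_matrix_def by blast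
qed

end
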